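(* For every constant $c>0$, if a graphical game is sampled from $\mathcal{D}_{(n,p)}$ with $p\le \frac{c}{n^2}$, the probability that a pure Nash equilibrium exists is at least $$\Big(1-\frac{c}{n^2}\Big)^{\frac{n(n-1)}{2}}\longrightarrow e^{-c/2},$$ where the limit is as $n\to+\infty$.
   Context: For a graph $G=(V,E)$ and $v\in V$, $\mathcal{N}(v)=\{v'\in V: (v,v')\in E\}$. Random best-response model $\mathcal{D}_G$: the players are the vertices of $G$, and each player $v$ has strategy set $S_v=\{0,1\}$. A (binary) game on $G$ is specified by best-response tables $\mathrm{BR}_v:\{0,1\}\times\{0,1\}^{\mathcal{N}(v)}\to\{0,1\}$, $v\in V$. Under $\mathcal{D}_G$, the values $\mathrm{BR}_v(0,\sigma_{\mathcal{N}(v)})$, over all $v\in V$ and all $\sigma_{\mathcal{N}(v)}\in\{0,1\}^{\mathcal{N}(v)}$, are mutually independent and uniform in $\{0,1\}$, and $\mathrm{BR}_v(1,\sigma_{\mathcal{N}(v)})=1-\mathrm{BR}_v(0,\sigma_{\mathcal{N}(v)})$. (This is the law, up to probability-zero events, of the best-response tables of a graphical game on $G$ all of whose payoff entries are i.i.d. from an atomless distribution on $\mathbb{R}$, where $\mathrm{BR}_v(\sigma_v,\sigma_{\mathcal{N}(v)})=1$ iff $\sigma_v$ maximizes the payoff of $v$ given $\sigma_{\mathcal{N}(v)}$.) A pure Nash equilibrium (PNE) is a profile $\sigma\in\{0,1\}^V$ with $\mathrm{BR}_v(\sigma_v,\sigma_{\mathcal{N}(v)})=1$ for all $v\in V$.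 The measure $\mathcal{D}_{(n,p)}$, for $n\in\mathbb{N}$ and $p\in[0,1]$: first draw $G$ from the Erdős–Rényi model $G(n,p)$ ($n$ vertices, each edge present independently with probability $p$), then draw a game from $\mathcal{D}_G$.
   Formalization: The bound is stated for n ≥ 1 under the extra condition c ≤ n² (not needed for n = 1), since for c > n² it can fail: n = 4, c = 160, p = 0 would require a probability of at least (1−10)^6 > 1. *)

theory Defs
  imports "HOL-Probability.Probability"
begin

text \<open>
  A simple graph is given by a vertex set \<open>V\<close> and a set \<open>E\<close> of edges, each edge being a
  two-element subset of \<open>V\<close>. The strategies 0 and 1 are \<open>False\<close> and \<open>True\<close>, and so are
  the values of best-response tables.
\<close>

definition nbhd :: "'a set \<Rightarrow> 'a set set \<Rightarrow> 'a \<Rightarrow> 'a set" where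
  "nbhd V E v = {u \<in> V. {v, u} \<in> E}"

definition profiles :: "'a set \<Rightarrow> ('a \<Rightarrow> bool) set" where
  "profiles A = A \<rightarrow>\<^sub>E UNIV"

text \<open>
  \<open>BR v s \<tau>\<close> is the table entry of player \<open>v\<close> at own strategy \<open>s\<close> and neighbour
  profile \<open>\<tau>\<close>; only \<open>v \<in> V\<close> and \<open>\<tau> \<in> profiles (nbhd V E v)\<close> are meaningful.
\<close>

type_synonym 'a br_tables = "'a \<Rightarrow> bool \<Rightarrow> ('a \<Rightarrow> bool) \<Rightarrow> bool"

definition is_PNE :: "'a set \<Rightarrow> 'a set set \<Rightarrow> 'a br_tables \<Rightarrow> ('a \<Rightarrow> bool) \<Rightarrow> bool" where
  "is_PNE V E BR \<sigma> \<longleftrightarrow>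
     \<sigma> \<in> profiles V \<and> (\<forall>v\<in>V. BR v (\<sigma> v) (restrict \<sigma> (nbhd V E v)))"

text \<open>
  The independent fair bits are \<open>t (v, \<tau>) = BR v 0 \<tau>\<close>; the entry at own strategy 1 is
  the complement. Outside the index set \<open>t\<close> is constantly \<open>False\<close>.
\<close>

definition game_pmf :: "'a set \<Rightarrow> 'a set set \<Rightarrow> 'a br_tables pmf" where
  "game_pmf V E =
     map_pmf (\<lambda>t v s \<tau>. if s then \<not> t (v, \<tau>) else t (v, \<tau>))
       (Pi_pmf (SIGMA v:V. profiles (nbhd V E v)) False (\<lambda>_. bernoulli_pmf (1 / 2)))"

definition all_pairs :: "nat \<Rightarrow> nat set set" where
  "all_pairs n = {e. e \<subseteq> {..<n} \<and> card e = 2}"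

definition erdos_renyi_pmf :: "nat \<Rightarrow> real \<Rightarrow> nat set set pmf" where
  "erdos_renyi_pmf n p =
     map_pmf (\<lambda>f. {e \<in> all_pairs n. f e})
       (Pi_pmf (all_pairs n) False (\<lambda>_. bernoulli_pmf p))"

definition random_game_pmf :: "nat \<Rightarrow> real \<Rightarrow> (nat set set \<times> nat br_tables) pmf" where
  "random_game_pmf n p =
     bind_pmf (erdos_renyi_pmf n p)
       (\<lambda>E. map_pmf (\<lambda>BR. (E, BR)) (game_pmf {..<n} E))"

end

theory Submission
  imports Defs "HOL-Real_Asymp.Real_Asymp"
begin

text \<open>
  Without edges every player is isolated and strictly prefers one of the two strategies whatever
  the others do, so an equilibrium exists surely. It therefore suffices that the
  random graph has no edge, which happens with probability \<open>(1 - p)^(n choose 2)\<close>.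
\<close>

lemma finite_all_pairs: "finite (all_pairs n)"
  unfolding all_pairs_def by (rule finite_subset[of _ "Pow {..<n}"]) auto

lemma card_all_pairs: "card (all_pairs n) = n * (n - 1) div 2"
  unfolding all_pairs_def using n_subsets[of "{..<n}" 2] by (simp add: choose_two)

lemma pmf_erdos_renyi_empty:
  assumes "0 \<le> p" "p \<le> 1"
  shows "pmf (erdos_renyi_pmf n p) {} = (1 - p) ^ (n * (n - 1) div 2)"
proof -
  let ?M = "Pi_pmf (all_pairs n) False (\<lambda>_. bernoulli_pmf p)"
  \<comment> \<open>The preimage of the empty graph leaves \<open>f\<close> free off
    \<open>all_pairs n\<close>. On the support \<open>f\<close> takes the default
    \<open>False\<close> there, so only one function remains.\<close>
  have "(\<lambda>f. {e \<in> all_pairs n. f e}) -` {{}} \<inter> set_pmf ?M = {\<lambda>_. False} \<inter> set_pmf ?M"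
    using set_Pi_pmf_subset[OF finite_all_pairs, of n False "\<lambda>_. bernoulli_pmf p"] by fastforce
  then have "pmf (erdos_renyi_pmf n p) {} = pmf ?M (\<lambda>_. False)"
    unfolding erdos_renyi_pmf_def pmf_map
    using measure_Int_set_pmf[of ?M "(\<lambda>f. {e \<in> all_pairs n. f e}) -` {{}}"]
      measure_Int_set_pmf[of ?M "{\<lambda>_. False}"]
    by (simp add: measure_pmf_single)
  also have "\<dots> = (1 - p) ^ card (all_pairs n)"
    using assms by (simp add: pmf_Pi finite_all_pairs)
  finally show ?thesis by (simp add: card_all_pairs)
qed

lemma PNE_exists_no_edges:
  assumes "BR \<in> set_pmf (game_pmf V {})"
  shows "\<exists>\<sigma>. is_PNE V {} BR \<sigma>"
proof -
  obtain t where BR: "BR = (\<lambda>v s \<tau>. if s then \<not> t (v, \<tau>) else t (v, \<tau>))"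
    using assms unfolding game_pmf_def by auto
  \<comment> \<open>With no neighbours, the only neighbour profile is the empty one,
    \<open>\<lambda>_. undefined\<close>. The bit \<open>t\<close> there says whether strategy 0 is
    the best response, so its negation is the dominant strategy.\<close>
  have "is_PNE V {} BR (restrict (\<lambda>v. \<not> t (v, \<lambda>_. undefined)) V)"
    by (auto simp: is_PNE_def BR profiles_def nbhd_def restrict_def)
  then show ?thesis by blast
qed

text \<open>Each conditional law of the tables has total mass 1, so events about the graph alone
  keep their Erdos-Renyi probability in the joint space.\<close>

lemma map_fst_random_game: "map_pmf fst (random_game_pmf n p) = erdos_renyi_pmf n p"
  by (simp add: random_game_pmf_def map_bind_pmf pmf.map_comp comp_def map_pmf_const
      bind_return_pmf')

lemma prob_PNE_ge:
  assumes "0 \<le> p" "p \<le> 1"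
  shows "(1 - p) ^ (n * (n - 1) div 2)
    \<le> measure_pmf.prob (random_game_pmf n p) {(E, BR). \<exists>\<sigma>. is_PNE {..<n} E BR \<sigma>}"
proof -
  let ?M = "random_game_pmf n p"
  have "(1 - p) ^ (n * (n - 1) div 2) = measure_pmf.prob ?M (fst -` {{}})"
    using pmf_erdos_renyi_empty[OF assms] by (simp flip: map_fst_random_game add: pmf_map)
  \<comment> \<open>Only on the support are the entries at strategies 0 and 1 complementary, which
    is what yields an equilibrium.\<close>
  also have "\<dots> = measure_pmf.prob ?M (fst -` {{}} \<inter> set_pmf ?M)"
    by (simp add: measure_Int_set_pmf)
  also have "\<dots> \<le> measure_pmf.prob ?M {(E, BR). \<exists>\<sigma>. is_PNE {..<n} E BR \<sigma>}"
    by (rule measure_pmf.finite_measure_mono)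
      (auto simp: random_game_pmf_def intro: PNE_exists_no_edges)
  finally show ?thesis .
qed

lemma no_edges_prob_tendsto:
  fixes c :: real
  shows "(\<lambda>n::nat. (1 - c / (real n)^2) ^ (n * (n - 1) div 2)) \<longlonglongrightarrow> exp (- c / 2)"
proof -
  have "(\<lambda>n::nat. (1 - c / (real n)^2) powr (real n * (real n - 1) / 2)) \<longlonglongrightarrow> exp (- c / 2)"
    by real_asymp
  moreover have "eventually (\<lambda>n::nat. 1 - c / (real n)^2 > 0) sequentially"
    by real_asymp
  \<comment> \<open>The limit was taken with a real exponent. A positive base makes
    \<open>powr\<close> agree with the natural power; \<open>n \<ge> 1\<close> lets the truncated
    \<open>n - 1\<close> become a real difference, and \<open>div 2\<close> is exact since n(n-1) is
    even.\<close>
  then have "eventually (\<lambda>n::nat. (1 - c / (real n)^2) powr (real n * (real n - 1) / 2)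
      = (1 - c / (real n)^2) ^ (n * (n - 1) div 2)) sequentially"
    using eventually_ge_at_top[of 1]
  proof eventually_elim
    case (elim n)
    have "real (n * (n - 1) div 2) = real n * (real n - 1) / 2"
      using elim(2) by (simp add: real_of_nat_div of_nat_diff)
    then show ?case using powr_realpow[OF elim(1), of "n * (n - 1) div 2"] by (simp only:)
  qed
  ultimately show ?thesis by (rule Lim_transform_eventually)
qed

theorem theorem1p11:
  fixes c :: real
  assumes "c > 0"
  shows "(\<forall>(n::nat) (p::real). n \<ge> 1 \<and> 0 \<le> p \<and> p \<le> 1 \<and> p \<le> c / (real n)^2
            \<and> (n = 1 \<or> c \<le> (real n)^2) \<longrightarrow>
           measure_pmf.prob (random_game_pmf n p) {(E, BR). \<exists>\<sigma>. is_PNE {..<n} E BR \<sigma>}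
             \<ge> (1 - c / (real n)^2) ^ (n * (n - 1) div 2))
       \<and> (\<lambda>n::nat. (1 - c / (real n)^2) ^ (n * (n - 1) div 2)) \<longlonglongrightarrow> exp (- c / 2)"
proof (intro conjI allI impI no_edges_prob_tendsto)
  fix n :: nat and p :: real
  assume h: "n \<ge> 1 \<and> 0 \<le> p \<and> p \<le> 1 \<and> p \<le> c / (real n)^2 \<and> (n = 1 \<or> c \<le> (real n)^2)"
  have "(1 - c / (real n)^2) ^ (n * (n - 1) div 2) \<le> (1 - p) ^ (n * (n - 1) div 2)"
  \<comment> \<open>For n = 1 the exponent is 0, whatever c is. Otherwise c \<le> n^2 keeps the
    smaller base nonnegative, as monotonicity of powers requires; an even power of a negative base
    could exceed 1.\<close>
  proof (cases "n = 1")
    case False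
    with h show ?thesis by (intro power_mono) (auto simp: divide_le_eq)
  qed simp
  also have "\<dots> \<le> measure_pmf.prob (random_game_pmf n p)
      {(E, BR). \<exists>\<sigma>. is_PNE {..<n} E BR \<sigma>}"
    using h by (intro prob_PNE_ge) auto
  finally show "(1 - c / (real n)^2) ^ (n * (n - 1) div 2)
      \<le> measure_pmf.prob (random_game_pmf n p) {(E, BR). \<exists>\<sigma>. is_PNE {..<n} E BR \<sigma>}" .
qed

end
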